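(* Let $p\in[2,\infty)$ and let $\omega_X$ be any non-zero, antisymmetric, bounded bilinear form on a $p$-uniformly convex real Banach space $X$. Then there are constants $C=C(X,\omega_X)>0$ and $\lambda=\lambda(X,\omega_X)>0$ such that the Koranyi-type norm $N_{p,\lambda}$ satisfies, for every $\mathbf a=(a,s),\ \mathbf b=(b,t)\in\mathbb H(\omega_X)$, $$\frac12N_{p,\lambda}(\mathbf a)^{2p}+\frac12N_{p,\lambda}(\mathbf b^{-1}\mathbf a)^{2p}\ \ge\ N_{p,\lambda}(\delta_{1/2}(\mathbf b))^{2p}+\frac1{C^{2p}}N_{p,\lambda}(\delta_{1/2}(\mathbf b)^{-1}\mathbf a)^{2p}.$$
   Context: A Banach space $X$ is **$p$-uniformly convex** if there is a constant $K\ge1$ such that for all $x,y\in X$, $\frac{\|x+y\|^p+\|x-y\|^p}{2}\ge\|x\|^p+\frac1{K^p}\|y\|^p$. **Heisenberg group.** $\mathbb H(\omega_X)$ is the set $X\times\mathbb R$ with the group law $(x,s)(y,t)=(x+y,\,s+t+\omega_X(x,y))$; inverses are $(x,s)^{-1}=(-x,-s)$. For $r>0$ the dilation $\delta_r$ is $\delta_r((x,s))=(rx,r^2s)$. **Koranyi-type norm.** For $p\in[1,\infty)$ and $\lambda>0$, $N_{p,\lambda}((x,s))=\big(\|x\|^{2p}+\lambda^{2p}|s|^p\big)^{1/(2p)}$. *)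

theory Defs
  imports "HOL-Analysis.Analysis"
begin

definition p_uniformly_convex :: "'a::banach itself \<Rightarrow> real \<Rightarrow> bool" where
  "p_uniformly_convex (_ :: 'a itself) p \<longleftrightarrow>
     (\<exists>K\<ge>1. \<forall>x y :: 'a.
        (norm (x + y) powr p + norm (x - y) powr p) / 2
          \<ge> norm x powr p + 1 / K powr p * norm y powr p)"

definition antisymmetric_form :: "('a \<Rightarrow> 'a \<Rightarrow> real) \<Rightarrow> bool" where
  "antisymmetric_form \<omega> \<longleftrightarrow> (\<forall>x y. \<omega> x y = - \<omega> y x)"

text \<open>The Heisenberg group of a form \<open>\<omega>\<close> has the underlying set \<open>'a \<times> real\<close>. Its operations are
  explicit functions, since the additive class structure of the product type is a different one.\<close>

definition heis_mult ::
  "('a::real_normed_vector \<Rightarrow> 'a \<Rightarrow> real) \<Rightarrow> 'a \<times> real \<Rightarrow> 'a \<times> real \<Rightarrow> 'a \<times> real" where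
  "heis_mult \<omega> a b = (fst a + fst b, snd a + snd b + \<omega> (fst a) (fst b))"

definition heis_inv :: "'a::real_normed_vector \<times> real \<Rightarrow> 'a \<times> real" where
  "heis_inv a = (- fst a, - snd a)"

definition heis_dilation :: "real \<Rightarrow> 'a::real_normed_vector \<times> real \<Rightarrow> 'a \<times> real" where
  "heis_dilation r a = (r *\<^sub>R fst a, r\<^sup>2 * snd a)"

definition koranyi_norm :: "real \<Rightarrow> real \<Rightarrow> 'a::real_normed_vector \<times> real \<Rightarrow> real" where
  "koranyi_norm p l a =
     (norm (fst a) powr (2 * p) + l powr (2 * p) * \<bar>snd a\<bar> powr p) powr (1 / (2 * p))"

lemma heis_mult_assoc:
  assumes "bounded_bilinear \<omega>"
  shows "heis_mult \<omega> (heis_mult \<omega> a b) c = heis_mult \<omega> a (heis_mult \<omega> b c)"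
  using assms
  by (simp add: heis_mult_def bounded_bilinear.add_left bounded_bilinear.add_right)

lemma heis_mult_unit:
  assumes "bounded_bilinear \<omega>"
  shows "heis_mult \<omega> (0, 0) a = a" "heis_mult \<omega> a (0, 0) = a"
  using assms
  by (simp_all add: heis_mult_def bounded_bilinear.zero_left bounded_bilinear.zero_right)

lemma heis_mult_inv:
  assumes "bounded_bilinear \<omega>" "antisymmetric_form \<omega>"
  shows "heis_mult \<omega> (heis_inv a) a = (0, 0)" "heis_mult \<omega> a (heis_inv a) = (0, 0)"
proof -
  have "\<omega> (fst a) (fst a) = - \<omega> (fst a) (fst a)"
    using assms(2) unfolding antisymmetric_form_def by blast
  then have "\<omega> (fst a) (fst a) = 0"
    by simp
  then show "heis_mult \<omega> (heis_inv a) a = (0, 0)" "heis_mult \<omega> a (heis_inv a) = (0, 0)"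
    using assms(1)
    by (simp_all add: heis_mult_def heis_inv_def bounded_bilinear.minus_left
        bounded_bilinear.minus_right)
qed

end

(* Put u = y/2 and v = x - y/2 for a = (x, s), b = (y, t). Squaring the p-uniform convexity
   inequality gives not only norm v powr (2 * p) but also the cross term
   norm u powr p * norm v powr p. The centre contributes a convexity inequality for powr p with an
   error of at most l powr (2 * p) * \<bar>\<omega> u v\<bar> powr p, which the cross term absorbs once l is small. *)

theory Submission
  imports Defs
begin

text \<open>This is convexity of \<open>powr p\<close>, applied to strictly positive arguments; when
  one argument vanishes, the claim reduces to \<open>(1 / 2) powr p \<le> 1 / 2\<close>.\<close>

lemma powr_midpoint_le:
  fixes p x y :: real
  assumes "p \<ge> 1"
  shows "\<bar>(x + y) / 2\<bar> powr p \<le> (\<bar>x\<bar> powr p + \<bar>y\<bar> powr p) / 2"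
proof (cases "x = 0 \<or> y = 0")
  case True
  have "(1 / 2) powr p \<le> (1 / 2 :: real) powr 1"
    using assms by (intro powr_mono') auto
  then have half: "(\<bar>z\<bar> / 2) powr p \<le> \<bar>z\<bar> powr p / 2" for z :: real
    using mult_right_mono[of "(1 / 2) powr p" "1 / 2" "\<bar>z\<bar> powr p"]
    by (simp add: powr_divide)
  show ?thesis
    using True half by auto
next
  case False
  have "\<bar>(x + y) / 2\<bar> powr p \<le> ((1 - 1/2) *\<^sub>R \<bar>x\<bar> + (1/2) *\<^sub>R \<bar>y\<bar>) powr p"
    using assms by (intro powr_mono2) auto
  also have "\<dots> \<le> (1 - 1/2) * \<bar>x\<bar> powr p + 1/2 * \<bar>y\<bar> powr p"
    using False by (intro convex_onD[OF powr_convex[OF assms]]) auto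
  finally show ?thesis by simp
qed

lemma powr_sum3_le:
  fixes p x y z :: real
  assumes "p \<ge> 0" "x \<ge> 0" "y \<ge> 0" "z \<ge> 0"
  shows "(x + y + z) powr p \<le> 3 powr p * (x powr p + y powr p + z powr p)"
proof -
  define m where "m = max x (max y z)"
  have "(x + y + z) powr p \<le> (3 * m) powr p"
    using assms by (intro powr_mono2) (auto simp: m_def)
  also have "\<dots> = 3 powr p * m powr p"
    using assms by (intro powr_mult)
  also have "m powr p \<le> x powr p + y powr p + z powr p"
    by (auto simp: m_def max_def)
  finally show ?thesis by simp
qed

lemma koranyi_norm_powr:
  assumes "p > 0"
  shows "koranyi_norm p l a powr (2 * p)
    = norm (fst a) powr (2 * p) + l powr (2 * p) * \<bar>snd a\<bar> powr p"
  using assms by (simp add: koranyi_norm_def powr_powr)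

text \<open>Both sides of the convexity hypothesis are nonnegative, so it may be squared, and the
  square of a mean is at most the mean of the squares. Expanding the other side produces the cross
  term.\<close>

lemma uniform_convexity_squared:
  fixes u v :: "'a::real_normed_vector"
  assumes "(norm (u + v) powr p + norm (u - v) powr p) / 2 \<ge> norm u powr p + k * norm v powr p"
    and "k \<ge> 0"
  shows "(norm (u + v) powr (2 * p) + norm (u - v) powr (2 * p)) / 2
    \<ge> norm u powr (2 * p) + 2 * k * (norm u powr p * norm v powr p) + k\<^sup>2 * norm v powr (2 * p)"
proof -
  have sq: "x powr (2 * p) = (x powr p)\<^sup>2" for x :: real
    by (simp add: power2_eq_square flip: powr_add)
  have "(norm u powr p + k * norm v powr p)\<^sup>2
    \<le> ((norm (u + v) powr p + norm (u - v) powr p) / 2)\<^sup>2"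
    using assms by (intro power_mono) auto
  also have "\<dots> \<le> ((norm (u + v) powr p)\<^sup>2 + (norm (u - v) powr p)\<^sup>2) / 2"
    using sum_squares_bound[of "norm (u + v) powr p" "norm (u - v) powr p"]
    by (simp add: power2_eq_square algebra_simps)
  finally show ?thesis
    unfolding sq by (simp add: power2_eq_square algebra_simps)
qed

text \<open>For \<open>w = \<omega> u v\<close>, the quantities \<open>s - t - 2 * w\<close> and
  \<open>s - t / 4 - w\<close> are the central coordinates of the two products in the theorem, and
  \<open>\<bar>w\<bar> powr p\<close> is the price of their twisting by the form.\<close>

lemma central_coordinate_convexity:
  fixes p c s t w :: real
  assumes "p \<ge> 1" "c \<ge> 0" "c * 3 powr p \<le> 1 / 4"
  shows "\<bar>t / 4\<bar> powr p + c * \<bar>s - t / 4 - w\<bar> powr p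
    \<le> (\<bar>s\<bar> powr p + \<bar>s - t - 2 * w\<bar> powr p) / 2 + \<bar>w\<bar> powr p"
proof -
  define r where "r = s - t - 2 * w"
  \<comment> \<open>Since \<open>t = s - r - 2 * w\<close>, the number \<open>t / 4\<close> is a
    midpoint of a midpoint. The outer halving spends only half of the available mean of
    \<open>\<bar>s\<bar> powr p\<close> and \<open>\<bar>r\<bar> powr p\<close>.\<close>
  have "\<bar>t / 4\<bar> powr p = \<bar>((s + - r) / 2 + - w) / 2\<bar> powr p"
    by (simp add: r_def field_simps)
  also have "\<dots> \<le> (\<bar>(s + - r) / 2\<bar> powr p + \<bar>- w\<bar> powr p) / 2"
    by (rule powr_midpoint_le[OF assms(1)])
  also have "\<dots> \<le> ((\<bar>s\<bar> powr p + \<bar>r\<bar> powr p) / 2 + \<bar>w\<bar> powr p) / 2"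
    using powr_midpoint_le[OF assms(1), of s "- r"] by simp
  finally have 1: "\<bar>t / 4\<bar> powr p \<le> ((\<bar>s\<bar> powr p + \<bar>r\<bar> powr p) / 2 + \<bar>w\<bar> powr p) / 2" .
  let ?S = "\<bar>s\<bar> powr p + \<bar>r\<bar> powr p + \<bar>w\<bar> powr p"
  have "s - t / 4 - w = (3 * s + r) / 4 - w / 2"
    by (simp add: r_def field_simps)
  then have "\<bar>s - t / 4 - w\<bar> \<le> \<bar>s\<bar> + \<bar>r\<bar> + \<bar>w\<bar>"
    by (simp only: abs_if split: if_split) argo
  then have "\<bar>s - t / 4 - w\<bar> powr p \<le> (\<bar>s\<bar> + \<bar>r\<bar> + \<bar>w\<bar>) powr p"
    using assms(1) by (intro powr_mono2) auto
  also have "\<dots> \<le> 3 powr p * ?S"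
    using assms by (intro powr_sum3_le) auto
  finally have "c * \<bar>s - t / 4 - w\<bar> powr p \<le> (c * 3 powr p) * ?S"
    using assms(2) by (simp add: mult_left_mono mult.assoc)
  \<comment> \<open>The factor 1/4 is what the first estimate leaves over for \<open>s\<close> and
    \<open>r\<close>; the \<open>w\<close> terms then add up to 3/4, below the allowed 1.\<close>
  also have "\<dots> \<le> 1 / 4 * ?S"
    using assms(3) by (intro mult_right_mono) auto
  finally show ?thesis
    using 1 powr_ge_zero[of "\<bar>w\<bar>" p] unfolding r_def[symmetric] by argo
qed

theorem proposition35:
  fixes \<omega> :: "'a::banach \<Rightarrow> 'a \<Rightarrow> real" and p :: real
  assumes "p \<ge> 2"
    and "p_uniformly_convex TYPE('a) p"
    and "bounded_bilinear \<omega>"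
    and "antisymmetric_form \<omega>"
    and "\<exists>x y. \<omega> x y \<noteq> 0"
  shows "\<exists>C>0. \<exists>l>0. \<forall>a b :: 'a \<times> real.
    1 / 2 * koranyi_norm p l a powr (2 * p)
      + 1 / 2 * koranyi_norm p l (heis_mult \<omega> (heis_inv b) a) powr (2 * p)
    \<ge> koranyi_norm p l (heis_dilation (1 / 2) b) powr (2 * p)
      + 1 / C powr (2 * p)
          * koranyi_norm p l (heis_mult \<omega> (heis_inv (heis_dilation (1 / 2) b)) a) powr (2 * p)"
proof -
  interpret bounded_bilinear \<omega> by fact
  obtain K where K: "K \<ge> 1" and convex: "\<And>x y :: 'a.
      (norm (x + y) powr p + norm (x - y) powr p) / 2 \<ge> norm x powr p + 1 / K powr p * norm y powr p"
    using assms(2) unfolding p_uniformly_convex_def by blast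
  obtain M where M: "M > 0" and \<omega>_le: "\<And>x y. \<bar>\<omega> x y\<bar> \<le> norm x * norm y * M"
    using pos_bounded by (auto simp: real_norm_def)
  have \<omega>_self: "\<omega> x x = 0" for x
    using assms(4) unfolding antisymmetric_form_def by (metis equation_minus_iff neg_equal_zero)
  define k where "k = 1 / K powr p"
  \<comment> \<open>The bound \<open>k\<^sup>2\<close> serves the horizontal part, the other one the
    central part.\<close>
  define c where "c = min (k\<^sup>2) (1 / (4 * 3 powr p))"
  \<comment> \<open>\<open>L\<close> plays the role of \<open>l powr (2 * p)\<close>. It is chosen
    so that \<open>L * M powr p\<close> equals \<open>2 * k\<close>, the coefficient of the cross
    term.\<close>
  define L where "L = 2 * k / M powr p"
  define C where "C = (1 / c) powr (1 / (2 * p))"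
  define l where "l = L powr (1 / (2 * p))"
  have pos: "k > 0" "c > 0" "L > 0" "C > 0" "l > 0"
    using K M by (auto simp: k_def c_def L_def C_def l_def min_def)
  have Cc: "1 / C powr (2 * p) = c" and lL: "l powr (2 * p) = L"
    using pos assms(1) by (simp_all add: C_def l_def powr_powr)
  have c_le: "c \<le> k\<^sup>2" "c * 3 powr p \<le> 1 / 4"
    by (auto simp: c_def min_def field_simps)
  show ?thesis
  proof (rule exI[of _ C], rule conjI[OF pos(4)], rule exI[of _ l], rule conjI[OF pos(5)],
      intro allI)
    fix a b :: "'a \<times> real"
    obtain x s y t where ab: "a = (x, s)" "b = (y, t)"
      by (metis surj_pair)
    \<comment> \<open>\<open>u\<close> and \<open>v\<close> are the horizontal coordinates of the
      dilated \<open>b\<close> and of its inverse times \<open>a\<close>. Those of \<open>a\<close>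
      and of \<open>b\<close> inverse times \<open>a\<close> become \<open>u + v\<close> and
      \<open>v - u\<close>, the shape that uniform convexity needs.\<close>
    define u where "u = (1 / 2) *\<^sub>R y"
    define v where "v = x - u"
    define w where "w = \<omega> u v"
    have y: "y = u + u"
      by (simp add: u_def flip: scaleR_add_left)
    then have xy: "x = u + v" "y = u + u" "- y + x = - (u - v)" "- u + x = v"
      by (simp_all add: v_def)
    have \<omega>_eq: "\<omega> u x = w" "\<omega> y x = 2 * w"
      by (simp_all add: w_def xy(1,2) add_left add_right \<omega>_self)
    have "\<bar>w\<bar> powr p \<le> (norm u * norm v * M) powr p"
      using \<omega>_le[of u v] assms(1) by (intro powr_mono2) (auto simp: w_def)
    also have "\<dots> = norm u powr p * norm v powr p * M powr p"
      using M by (simp add: powr_mult)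
    finally have "L * \<bar>w\<bar> powr p \<le> L * (norm u powr p * norm v powr p * M powr p)"
      using pos(3) by (intro mult_left_mono) auto
    then have Lw: "L * \<bar>w\<bar> powr p \<le> 2 * k * (norm u powr p * norm v powr p)"
      using M by (simp add: L_def)
    have "norm u powr (2 * p) + c * norm v powr (2 * p) + L * \<bar>w\<bar> powr p
        \<le> norm u powr (2 * p) + k\<^sup>2 * norm v powr (2 * p)
          + 2 * k * (norm u powr p * norm v powr p)"
      using Lw c_le(1) by (intro add_mono mult_right_mono) auto
    also have "\<dots> \<le> (norm (u + v) powr (2 * p) + norm (u - v) powr (2 * p)) / 2"
      using uniform_convexity_squared[where u = u and v = v and p = p and k = k] convex[of u v] pos(1)
      by (simp add: k_def)
    finally have horizontal: "norm u powr (2 * p) + c * norm v powr (2 * p) + L * \<bar>w\<bar> powr p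
        \<le> (norm (u + v) powr (2 * p) + norm (u - v) powr (2 * p)) / 2" .
    have central: "L * (\<bar>t / 4\<bar> powr p + c * \<bar>s - t / 4 - w\<bar> powr p)
        \<le> L * ((\<bar>s\<bar> powr p + \<bar>s - t - 2 * w\<bar> powr p) / 2 + \<bar>w\<bar> powr p)"
      using pos assms(1) c_le(2) by (intro mult_left_mono central_coordinate_convexity) auto
    have norm_a: "koranyi_norm p l a powr (2 * p) = norm (u + v) powr (2 * p) + L * \<bar>s\<bar> powr p"
      using assms(1) by (simp add: koranyi_norm_powr ab lL xy(1))
    have "heis_mult \<omega> (heis_inv b) a = (- (u - v), s - t - 2 * w)"
      using xy(3) by (simp add: heis_mult_def heis_inv_def ab minus_left \<omega>_eq)
    then have norm_ba: "koranyi_norm p l (heis_mult \<omega> (heis_inv b) a) powr (2 * p)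
        = norm (u - v) powr (2 * p) + L * \<bar>s - t - 2 * w\<bar> powr p"
      using assms(1) by (simp add: koranyi_norm_powr lL norm_minus_commute)
    have db: "heis_dilation (1 / 2) b = (u, t / 4)"
      by (simp add: heis_dilation_def ab u_def power2_eq_square)
    have norm_db: "koranyi_norm p l (heis_dilation (1 / 2) b) powr (2 * p)
        = norm u powr (2 * p) + L * \<bar>t / 4\<bar> powr p"
      unfolding db using assms(1) by (simp add: koranyi_norm_powr lL)
    have "heis_mult \<omega> (heis_inv (heis_dilation (1 / 2) b)) a = (v, s - t / 4 - w)"
      unfolding db using xy(4) by (simp add: heis_mult_def heis_inv_def ab minus_left \<omega>_eq)
    then have norm_dba:
      "koranyi_norm p l (heis_mult \<omega> (heis_inv (heis_dilation (1 / 2) b)) a) powr (2 * p)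
        = norm v powr (2 * p) + L * \<bar>s - t / 4 - w\<bar> powr p"
      using assms(1) by (simp add: koranyi_norm_powr lL)
    show "1 / 2 * koranyi_norm p l a powr (2 * p)
      + 1 / 2 * koranyi_norm p l (heis_mult \<omega> (heis_inv b) a) powr (2 * p)
    \<ge> koranyi_norm p l (heis_dilation (1 / 2) b) powr (2 * p)
      + 1 / C powr (2 * p)
          * koranyi_norm p l (heis_mult \<omega> (heis_inv (heis_dilation (1 / 2) b)) a) powr (2 * p)"
      \<comment> \<open>The error \<open>L * \<bar>w\<bar> powr p\<close> stands on the smaller side
        of \<open>horizontal\<close> and on the larger side of \<open>central\<close>, so it cancels
        when the two are added.\<close>
      unfolding norm_a norm_ba norm_db norm_dba Cc
      using horizontal central by (simp add: algebra_simps add_divide_distrib)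
  qed
qed

end
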